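(* For every real $a>0$, $$\lim_{x\rightarrow 0^+}\left[\int_x^\infty\frac{a\,dt}{\left(e^t-1\right)\left(e^{at}-1\right)}-\frac1x-\frac{1+a}{2}\ln x\right]=S(a)-\frac{\ln(2\pi)-\gamma}{2}.$$
   Context: Let $\psi(u)=\frac{d\ln\Gamma(u)}{du}$ be the digamma function and let $\gamma$ be the Euler-Mascheroni constant. For real $a>0$ define $$S(a)=\sum_{n=1}^\infty\left[\ln\frac{n}{a}-\frac{a}{2n}-\psi\left(\frac{n}{a}\right)\right].$$ *)

theory Defs
  imports "HOL-Analysis.Analysis"
begin

definition S_term :: "real \<Rightarrow> nat \<Rightarrow> real" where
  "S_term a n = ln (real n / a) - a / (2 * real n) - Digamma (real n / a)"

text \<open>The series starts at \<open>n = 1\<close>, hence the shift.\<close>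

definition S :: "real \<Rightarrow> real" where
  "S a = (\<Sum>n. S_term a (Suc n))"

text \<open>The library defines \<^const>\<open>Polygamma\<close> by a series; on the positive reals
  its \<open>Digamma\<close> is the logarithmic derivative of the Gamma function.\<close>

lemma Digamma_eq_deriv_ln_Gamma:
  fixes u :: real
  assumes "u > 0"
  shows "Digamma u = deriv (\<lambda>v. ln (Gamma v)) u"
proof -
  have "(ln_Gamma has_field_derivative Digamma u) (at u)"
    using assms by (rule has_field_derivative_ln_Gamma_real)
  moreover have "eventually (\<lambda>v. ln_Gamma v = ln (Gamma v)) (nhds u)"
    using eventually_nhds_in_open[of "{0<..}" u] assms
    by (auto elim!: eventually_mono simp: ln_Gamma_real_pos)
  ultimately have "((\<lambda>v. ln (Gamma v)) has_field_derivative Digamma u) (at u)"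
    using DERIV_cong_ev[of u u ln_Gamma "\<lambda>v. ln (Gamma v)" "Digamma u" "Digamma u"] by simp
  then show ?thesis
    by (rule DERIV_imp_deriv[symmetric])
qed

end

(*
  Write phi(t) = 1/2 + 1/(e^t - 1) - 1/t (called binet below).  Telescoping the trapezoid errors
  1/(2z) + 1/(2(z+1)) - ln((z+1)/z) along z, z+1, z+2, ... gives ln z - 1/(2z) - psi(z), and each
  error is the Laplace transform of a nonnegative function, so by monotone convergence
  ln z - 1/(2z) - psi(z) is the integral of e^(-zt) phi(t).  Putting z = n/a, substituting t = as
  and summing over n gives S(a) as the integral over (0,oo) of K_a(s) = a phi(as) / (e^s - 1).
  The difference K_a - K_1 equals a / ((e^s - 1)(e^(as) - 1)) up to multiples of 1/(e^s - 1) and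
  1/(e^s - 1)^2, whose integrals over [x,oo) are elementary; so the limit is S(a) - S(1) - 1/2.
  Finally S(1) has explicit partial sums in terms of N! and the harmonic numbers: its
  convergence yields Stirling's formula up to a constant, and Wallis' product gives the constant.
*)

theory Submission
  imports Defs "HOL-Real_Asymp.Real_Asymp"
begin

section \<open>Trapezoid errors of 1/u as Laplace transforms\<close>

lemma nn_integral_exp_minus_Ioi:
  fixes z :: real
  assumes "z > 0"
  shows "(\<integral>\<^sup>+t. ennreal (exp (- z * t)) * indicator {0<..} t \<partial>lborel) = ennreal (1 / z)"
proof -
  \<comment> \<open>Adding the null set {0} gives a closed half-line, where the fundamental theorem
    of calculus applies.\<close>
  have "(\<integral>\<^sup>+t. ennreal (exp (- z * t)) * indicator {0<..} t \<partial>lborel)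
      = (\<integral>\<^sup>+t. ennreal (exp (- z * t)) * indicator {0..} t \<partial>lborel)"
    using AE_lborel_singleton[of "0::real"]
    by (intro nn_integral_cong_AE) (auto simp: indicator_def)
  also have "\<dots> = ennreal (0 - (- exp (- z * 0) / z))"
  proof (rule nn_integral_FTC_atLeast)
    show "((\<lambda>t. - exp (- z * t) / z) \<longlongrightarrow> 0) at_top"
      using assms by real_asymp
  qed (use assms in \<open>auto intro!: derivative_eq_intros\<close>)
  finally show ?thesis by simp
qed

text \<open>The integrand is itself the integral of e^(-ut) over u in [z, z+1]. Tonelli exchanges
  the two integrations, after which the integral over t is 1/u.\<close>

lemma nn_integral_frullani_exp:
  fixes z :: real
  assumes z: "z > 0"
  shows "(\<integral>\<^sup>+t. ennreal (exp (- z * t) * ((1 - exp (- t)) / t)) * indicator {0<..} t \<partial>lborel)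
       = ennreal (ln (z + 1) - ln z)"
proof -
  have inner: "(\<integral>\<^sup>+u. ennreal (exp (- u * t)) * indicator {z..z + 1} u \<partial>lborel)
      = ennreal (exp (- z * t) * ((1 - exp (- t)) / t))" if "t > 0" for t
  proof -
    have "(\<integral>\<^sup>+u. ennreal (exp (- u * t)) * indicator {z..z + 1} u \<partial>lborel)
        = ennreal (- exp (- (z + 1) * t) / t - (- exp (- z * t) / t))"
      using that by (intro nn_integral_FTC_Icc) (auto intro!: derivative_eq_intros)
    also have "- exp (- (z + 1) * t) / t - (- exp (- z * t) / t) = exp (- z * t) * ((1 - exp (- t)) / t)"
      using that by (simp add: field_simps flip: exp_add)
    finally show ?thesis .
  qed
  have "(\<integral>\<^sup>+t. ennreal (exp (- z * t) * ((1 - exp (- t)) / t)) * indicator {0<..} t \<partial>lborel)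
      = (\<integral>\<^sup>+t. (\<integral>\<^sup>+u. ennreal (exp (- u * t)) * indicator {z..z + 1} u * indicator {0<..} t \<partial>lborel) \<partial>lborel)"
  proof (intro nn_integral_cong)
    fix t :: real
    show "ennreal (exp (- z * t) * ((1 - exp (- t)) / t)) * indicator {0<..} t =
        (\<integral>\<^sup>+u. ennreal (exp (- u * t)) * indicator {z..z + 1} u * indicator {0<..} t \<partial>lborel)"
      using inner[of t] by (cases "t > 0") simp_all
  qed
  also have "\<dots> = (\<integral>\<^sup>+u. (\<integral>\<^sup>+t. ennreal (exp (- u * t)) * indicator {z..z + 1} u * indicator {0<..} t \<partial>lborel) \<partial>lborel)"
    by (rule lborel_pair.Fubini') simp
  also have "\<dots> = (\<integral>\<^sup>+u. ennreal (1 / u) * indicator {z..z + 1} u \<partial>lborel)"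
    using nn_integral_exp_minus_Ioi z
    by (intro nn_integral_cong) (auto split: split_indicator)
  also have "\<dots> = ennreal (ln (z + 1) - ln z)"
    using z by (intro nn_integral_FTC_Icc) (auto intro!: derivative_eq_intros)
  finally show ?thesis .
qed

text \<open>By convexity: the left side is the mean of e^(-u) over [0, t], the right side the
  trapezoid value. The proof clears denominators, so that \<open>f\<close> vanishes at 0 and has
  derivative 1 - (1 + x) e^(-x) \<ge> 0.\<close>

lemma exp_minus_chord_le:
  fixes t :: real
  assumes "t > 0"
  shows "(1 - exp (- t)) / t \<le> (1 + exp (- t)) / 2"
proof -
  define f where "f = (\<lambda>t::real. t * (1 + exp (- t)) - 2 * (1 - exp (- t)))"
  have "f 0 \<le> f t"
  proof (rule DERIV_nonneg_imp_nondecreasing[of 0 t f])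
    fix x :: real
    have "(1 + x) * exp (- x) \<le> exp x * exp (- x)"
      by (intro mult_right_mono exp_ge_add_one_self) auto
    then have "1 - (1 + x) * exp (- x) \<ge> 0" by (simp flip: exp_add)
    moreover have "(f has_real_derivative 1 - (1 + x) * exp (- x)) (at x)"
      unfolding f_def by (auto intro!: derivative_eq_intros simp: algebra_simps)
    ultimately show "\<exists>y. (f has_real_derivative y) (at x) \<and> 0 \<le> y"
      by blast
  qed (use assms in auto)
  then show ?thesis using assms by (simp add: f_def field_simps)
qed

text \<open>The right side is the error of the trapezoid rule for 1/u on [z, z+1]: \<open>?A\<close>
  transforms into the trapezoid value, \<open>?B\<close> into the exact integral.\<close>

lemma nn_integral_trapezoid_gap:
  fixes z :: real
  assumes z: "z > 0"
  shows "(\<integral>\<^sup>+t. ennreal (exp (- z * t) * ((1 + exp (- t)) / 2 - (1 - exp (- t)) / t)) * indicator {0<..} t \<partial>lborel)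
       = ennreal (1 / (2 * z) + 1 / (2 * (z + 1)) - (ln (z + 1) - ln z))"
proof -
  let ?A = "\<lambda>t. exp (- z * t) * ((1 + exp (- t)) / 2)"
  let ?B = "\<lambda>t. exp (- z * t) * ((1 - exp (- t)) / t)"
  have A: "(\<integral>\<^sup>+t. ennreal (?A t) * indicator {0<..} t \<partial>lborel) = ennreal (1 / (2 * z) + 1 / (2 * (z + 1)))"
  proof -
    define c :: real where "c = 1 / 2"
    have c: "c \<ge> 0" by (simp add: c_def)
    have "?A t = c * exp (- z * t) + c * exp (- (z + 1) * t)" for t
      by (simp add: c_def field_simps flip: exp_add)
    then have "(\<integral>\<^sup>+t. ennreal (?A t) * indicator {0<..} t \<partial>lborel) =
        (\<integral>\<^sup>+t. ennreal (c * exp (- z * t) + c * exp (- (z + 1) * t)) * indicator {0<..} t \<partial>lborel)"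
      by (simp only:)
    also have "\<dots> = (\<integral>\<^sup>+t. ennreal c * (ennreal (exp (- z * t)) * indicator {0<..} t)
           + ennreal c * (ennreal (exp (- (z + 1) * t)) * indicator {0<..} t) \<partial>lborel)"
      using c by (intro nn_integral_cong) (simp add: ennreal_mult' split: split_indicator del: times_divide_eq_right)
    also have "\<dots> = ennreal c * (\<integral>\<^sup>+t. ennreal (exp (- z * t)) * indicator {0<..} t \<partial>lborel)
        + ennreal c * (\<integral>\<^sup>+t. ennreal (exp (- (z + 1) * t)) * indicator {0<..} t \<partial>lborel)"
      by (simp add: nn_integral_add nn_integral_cmult)
    also have "\<dots> = ennreal c * ennreal (1 / z) + ennreal c * ennreal (1 / (z + 1))"
      using z by (subst (1 2) nn_integral_exp_minus_Ioi) auto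
    also have "\<dots> = ennreal (c * (1 / z) + c * (1 / (z + 1)))"
      using z c by (subst ennreal_plus) (simp_all add: ennreal_mult' del: times_divide_eq_right)
    also have "c * (1 / z) + c * (1 / (z + 1)) = 1 / (2 * z) + 1 / (2 * (z + 1))"
      by (simp add: c_def)
    finally show ?thesis .
  qed
  have "(\<integral>\<^sup>+t. ennreal (?A t - ?B t) * indicator {0<..} t \<partial>lborel)
      = (\<integral>\<^sup>+t. ennreal (?A t) * indicator {0<..} t - ennreal (?B t) * indicator {0<..} t \<partial>lborel)"
    by (intro nn_integral_cong) (auto simp: ennreal_minus split: split_indicator)
  also have "\<dots> = ennreal (1 / (2 * z) + 1 / (2 * (z + 1))) - ennreal (ln (z + 1) - ln z)"
  \<comment> \<open>Extended nonnegative integrals may be subtracted here because the one of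
    \<open>?B\<close> is finite and \<open>?B\<close> is dominated by \<open>?A\<close>.\<close>
  proof (subst nn_integral_diff)
    show "(\<integral>\<^sup>+t. ennreal (?B t) * indicator {0<..} t \<partial>lborel) \<noteq> \<infinity>"
      by (subst nn_integral_frullani_exp[OF z]) simp
    show "AE t in lborel. ennreal (?B t) * indicator {0<..} t \<le> ennreal (?A t) * indicator {0<..} t"
    proof (rule AE_I2)
      fix t :: real
      have "ennreal (?B t) \<le> ennreal (?A t)" if "t > 0"
        by (intro ennreal_leI mult_left_mono exp_minus_chord_le that) simp
      then show "ennreal (?B t) * indicator {0<..} t \<le> ennreal (?A t) * indicator {0<..} t"
        unfolding indicator_def by simp
    qed
  qed (simp, simp, simp only: A nn_integral_frullani_exp[OF z])
  also have "\<dots> = ennreal (1 / (2 * z) + 1 / (2 * (z + 1)) - (ln (z + 1) - ln z))"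
    using z by (intro ennreal_minus) simp
  finally show ?thesis by (simp add: right_diff_distrib)
qed

section \<open>Telescoping series for the digamma function\<close>

text \<open>The recurrence reduces psi(z+k) to psi(z) plus a finite harmonic-type sum, and
  \<open>Digamma_LIMSEQ\<close> says that ln k minus this sum tends to psi(z). Replacing ln k by
  ln(z+k) costs o(1).\<close>

lemma Digamma_asymp_shift:
  fixes z :: real
  assumes z: "z > 0"
  shows "(\<lambda>k. ln (z + real k) - Digamma (z + real k)) \<longlonglongrightarrow> 0"
proof -
  have rec: "Digamma (z + real k) = Digamma z + (\<Sum>n<k. inverse (z + real n))" for k
  proof (induction k)
    case (Suc k)
    have "Digamma (z + real (Suc k)) = Digamma (z + real k) + inverse (z + real k)"
      using Digamma_plus1[of "z + real k"] z by (simp add: add_ac inverse_eq_divide)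
    then show ?case by (simp add: Suc)
  qed simp
  have "(\<lambda>k. (ln (real k) - (\<Sum>n<k. inverse (z + real n))) - Digamma z) \<longlonglongrightarrow> Digamma z - Digamma z"
    using Digamma_LIMSEQ[of z] z by (intro tendsto_intros) auto
  moreover have "(\<lambda>k. ln (z + real k) - ln (real k)) \<longlonglongrightarrow> 0"
    by real_asymp
  ultimately have "(\<lambda>k. ((ln (real k) - (\<Sum>n<k. inverse (z + real n))) - Digamma z)
      + (ln (z + real k) - ln (real k))) \<longlonglongrightarrow> (Digamma z - Digamma z) + 0"
    by (rule tendsto_add)
  then show ?thesis by (simp add: rec algebra_simps)
qed

lemma ln_minus_Digamma_sums:
  fixes z :: real
  assumes z: "z > 0"
  shows "(\<lambda>k. 1 / (2 * (z + real k)) + 1 / (2 * (z + real k + 1)) - (ln (z + real k + 1) - ln (z + real k)))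
           sums (ln z - 1 / (2 * z) - Digamma z)"
proof -
  let ?D = "\<lambda>k. (ln (z + real k) - Digamma (z + real k)) - 1 / (2 * (z + real k))"
  have "(\<lambda>k. 1 / (2 * (z + real k))) \<longlonglongrightarrow> 0"
    by real_asymp
  from tendsto_diff[OF Digamma_asymp_shift[OF z] this]
  have "(\<lambda>k. ?D k - ?D (Suc k)) sums (?D 0 - 0)"
    by (intro telescope_sums') simp
  moreover have "?D k - ?D (Suc k)
     = 1 / (2 * (z + real k)) + 1 / (2 * (z + real k + 1)) - (ln (z + real k + 1) - ln (z + real k))" for k
  proof -
    have "Digamma (z + real (Suc k)) = Digamma (z + real k) + 1 / (z + real k)"
      using Digamma_plus1[of "z + real k"] z by (simp add: add_ac)
    \<comment> \<open>One half of the recurrence increment cancels the term -1/(2(z+k)) of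
      \<open>?D k\<close>; the other half is the left endpoint of the trapezoid.\<close>
    moreover have "1 / (z + real k) = 1 / (2 * (z + real k)) + 1 / (2 * (z + real k))"
      using z by (simp add: field_simps)
    moreover have "z + real (Suc k) = z + real k + 1" by simp
    ultimately show ?thesis by (simp only:)
  qed
  ultimately show ?thesis by (simp only: of_nat_0) (simp add: algebra_simps)
qed

section \<open>Binet's integral for ln z - 1/(2z) - psi(z)\<close>

text \<open>Monotone convergence for series, applied once to the shifts z+k and once to the sum over
  n defining S(a).\<close>

lemma suminf_nn_integral:
  fixes F :: "nat \<Rightarrow> real \<Rightarrow> real" and G :: "real \<Rightarrow> real"
  assumes meas: "\<And>k. F k \<in> borel_measurable borel"
    and nonneg: "\<And>k t. t > 0 \<Longrightarrow> F k t \<ge> 0"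
    and sums: "\<And>t. t > 0 \<Longrightarrow> (\<lambda>k. F k t) sums G t"
  shows "(\<Sum>k. \<integral>\<^sup>+t. ennreal (F k t) * indicator {0<..} t \<partial>lborel)
       = (\<integral>\<^sup>+t. ennreal (G t) * indicator {0<..} t \<partial>lborel)"
proof -
  have "(\<Sum>k. \<integral>\<^sup>+t. ennreal (F k t) * indicator {0<..} t \<partial>lborel)
      = (\<integral>\<^sup>+t. (\<Sum>k. ennreal (F k t) * indicator {0<..} t) \<partial>lborel)"
    using meas by (intro nn_integral_suminf[symmetric]) simp
  also have "\<dots> = (\<integral>\<^sup>+t. ennreal (G t) * indicator {0<..} t \<partial>lborel)"
    by (intro nn_integral_cong)
       (auto simp: suminf_ennreal_eq[OF nonneg sums] split: split_indicator)
  finally show ?thesis .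
qed

lemma exp_minus_geometric_sums:
  fixes t :: real
  assumes "t > 0"
  shows "(\<lambda>k. exp (- real k * t)) sums (1 / (1 - exp (- t)))"
proof -
  have "(\<lambda>k. exp (- t) ^ k) sums (1 / (1 - exp (- t)))"
    using assms by (intro geometric_sums) simp
  then show ?thesis by (simp flip: exp_of_nat_mult)
qed

text \<open>The factor that, divided by t, forms the kernel of Binet's first formula for ln Gamma.
  It behaves like t/12 near 0 and tends to 1/2 at infinity.\<close>

definition binet :: "real \<Rightarrow> real" where
  "binet t = 1 / 2 + 1 / (exp t - 1) - 1 / t"

lemma binet_measurable [measurable]: "binet \<in> borel_measurable borel"
  unfolding binet_def by measurable

text \<open>The form in which \<open>binet\<close> arises: the trapezoid kernel times the geometric
  series of e^(-kt).\<close>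

lemma binet_eq:
  assumes "t > 0"
  shows "binet t = ((1 + exp (- t)) / 2 - (1 - exp (- t)) / t) * (1 / (1 - exp (- t)))"
proof -
  have "exp t > 1" using assms by simp
  then show ?thesis using assms
    by (simp add: binet_def exp_minus divide_simps)
qed

lemma binet_nonneg: "t > 0 \<Longrightarrow> binet t \<ge> 0"
  using exp_minus_chord_le[of t] by (simp add: binet_eq)

text \<open>A linear bound at 0 is what later cancels the pole of 1/(e^s - 1). It comes from e^t - 1
  \<ge> t + t^2/2 and partial fractions.\<close>

lemma binet_le:
  assumes "t > 0"
  shows "binet t \<le> t / 4"
proof -
  have "1 + t + t\<^sup>2 / 2 \<le> exp t" using assms by (intro exp_lower_Taylor_quadratic) simp
  then have "1 / (exp t - 1) \<le> 1 / (t + t\<^sup>2 / 2)"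
    using assms by (intro divide_left_mono) (auto intro!: mult_pos_pos add_pos_pos)
  also have "t + t\<^sup>2 / 2 = t * (2 + t) / 2"
    by (simp add: power2_eq_square field_simps)
  also have "1 / (t * (2 + t) / 2) = 1 / t - 1 / (2 + t)"
    using assms by (simp add: divide_simps)
  \<comment> \<open>The convex function 1/(2+t) lies above its tangent 1/2 - t/4 at t = 0.\<close>
  also have "\<dots> \<le> 1 / t - (1 / 2 - t / 4)"
    using assms by (simp add: divide_simps) (simp add: algebra_simps)
  finally show ?thesis by (simp add: binet_def)
qed

text \<open>Summing the trapezoid errors over z+k telescopes on one side and is a geometric series
  under the integral on the other. Nonnegativity is recorded separately because
  \<open>ennreal\<close> sends negative numbers to 0.\<close>

theorem nn_integral_binet:
  fixes z :: real
  assumes z: "z > 0"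
  shows "(\<integral>\<^sup>+t. ennreal (exp (- z * t) * binet t) * indicator {0<..} t \<partial>lborel)
       = ennreal (ln z - 1 / (2 * z) - Digamma z)"
    and "ln z - 1 / (2 * z) - Digamma z \<ge> 0"
proof -
  let ?h = "\<lambda>t. (1 + exp (- t)) / 2 - (1 - exp (- t)) / t"
  let ?g = "\<lambda>k. 1 / (2 * (z + real k)) + 1 / (2 * (z + real k + 1)) - (ln (z + real k + 1) - ln (z + real k))"
  have h: "?h t \<ge> 0" if "t > 0" for t :: real using exp_minus_chord_le[OF that] by simp
  have g: "?g k \<ge> 0" for k
  proof -
    have "(inverse (z + real k) + inverse (z + real k + 1)) / 2 = 1 / (2 * (z + real k)) + 1 / (2 * (z + real k + 1))"
      by (simp add: inverse_eq_divide add_divide_distrib algebra_simps)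
    then show ?thesis using ln_inverse_approx_le[of "z + real k" 1] z by simp
  qed
  show "ln z - 1 / (2 * z) - Digamma z \<ge> 0"
    using sums_le[OF _ sums_zero ln_minus_Digamma_sums[OF z]] g by simp
  have "(\<integral>\<^sup>+t. ennreal (exp (- z * t) * binet t) * indicator {0<..} t \<partial>lborel)
      = (\<Sum>k. \<integral>\<^sup>+t. ennreal (exp (- (z + real k) * t) * ?h t) * indicator {0<..} t \<partial>lborel)"
  proof (rule suminf_nn_integral[symmetric])
    fix t :: real assume t: "t > 0"
    have "(\<lambda>k. exp (- z * t) * ?h t * exp (- real k * t)) sums (exp (- z * t) * ?h t * (1 / (1 - exp (- t))))"
      by (intro sums_mult exp_minus_geometric_sums t)
    moreover have "exp (- z * t) * ?h t * exp (- real k * t) = exp (- (z + real k) * t) * ?h t" for k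
      by (simp add: ring_distribs exp_add exp_diff exp_minus field_simps)
    ultimately show "(\<lambda>k. exp (- (z + real k) * t) * ?h t) sums (exp (- z * t) * binet t)"
      by (simp only: binet_eq[OF t] mult.assoc)
  qed (use h in auto)
  also have "\<dots> = (\<Sum>k. ennreal (?g k))"
    using z by (intro suminf_cong nn_integral_trapezoid_gap) simp
  also have "\<dots> = ennreal (ln z - 1 / (2 * z) - Digamma z)"
    by (intro suminf_ennreal_eq g ln_minus_Digamma_sums z)
  finally show "(\<integral>\<^sup>+t. ennreal (exp (- z * t) * binet t) * indicator {0<..} t \<partial>lborel)
       = ennreal (ln z - 1 / (2 * z) - Digamma z)" .
qed

section \<open>S(a) as the integral of a kernel\<close>

lemma S_term_eq: "S_term a n = ln (real n / a) - 1 / (2 * (real n / a)) - Digamma (real n / a)"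
  by (simp add: S_term_def)

lemma S_term_nonneg:
  assumes "a > 0"
  shows "S_term a (Suc n) \<ge> 0"
  unfolding S_term_eq using assms by (intro nn_integral_binet(2)) simp

text \<open>The sum over n \<ge> 1 of the Binet integrands at z = n/a after t = a s. This
  substitution turns the exponentials into e^(-ns), free of a, so that kernels with different a
  share the denominator e^s - 1.\<close>

definition S_kernel :: "real \<Rightarrow> real \<Rightarrow> real" where
  "S_kernel a s = a * binet (a * s) / (exp s - 1)"

lemma S_kernel_measurable [measurable]: "S_kernel a \<in> borel_measurable borel"
  unfolding S_kernel_def by measurable

lemma S_kernel_nonneg: "a > 0 \<Longrightarrow> s > 0 \<Longrightarrow> S_kernel a s \<ge> 0"
  unfolding S_kernel_def using binet_nonneg[of "a * s"] by simp

text \<open>An integrable majorant: e^s - 1 = (e^(s/2) - 1)(e^(s/2) + 1) \<ge> (s/2) e^(s/2), whose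
  factor s cancels the one from \<open>binet_le\<close>.\<close>

lemma S_kernel_le:
  assumes "a > 0" "s > 0"
  shows "S_kernel a s \<le> a\<^sup>2 / 2 * exp (- (1 / 2) * s)"
proof -
  have "s / 2 \<le> exp (s / 2) - 1"
    using exp_ge_add_one_self[of "s / 2"] by linarith
  then have "s / 2 * exp (s / 2) \<le> (exp (s / 2) - 1) * (exp (s / 2) + 1)"
    by (rule mult_mono) (use assms in auto)
  also have "\<dots> = exp s - 1"
    by (simp add: algebra_simps flip: exp_add)
  finally have exp_bound: "s / 2 * exp (s / 2) \<le> exp s - 1" .
  have "S_kernel a s \<le> (a * (a * s / 4)) / (s / 2 * exp (s / 2))"
    unfolding S_kernel_def using assms binet_le[of "a * s"] exp_bound
    by (intro frac_le mult_left_mono) auto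
  also have "\<dots> = a\<^sup>2 / 2 * exp (- (1 / 2) * s)"
    using assms by (simp add: field_simps power2_eq_square exp_minus)
  finally show ?thesis .
qed

lemma nn_integral_S_kernel:
  assumes a: "a > 0"
  shows "(\<integral>\<^sup>+s. ennreal (S_kernel a s) * indicator {0<..} s \<partial>lborel) = (\<Sum>n. ennreal (S_term a (Suc n)))"
proof -
  have "ennreal (S_term a (Suc n))
      = (\<integral>\<^sup>+s. ennreal (a * binet (a * s) * exp (- real (Suc n) * s)) * indicator {0<..} s \<partial>lborel)" for n
  proof -
    let ?z = "real (Suc n) / a"
    have "ennreal (S_term a (Suc n)) = (\<integral>\<^sup>+t. ennreal (exp (- ?z * t) * binet t) * indicator {0<..} t \<partial>lborel)"
      using a unfolding S_term_eq by (intro nn_integral_binet(1)[symmetric]) simp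
    \<comment> \<open>The substitution t = a s, as an affine map with offset 0.\<close>
    also have "\<dots> = ennreal \<bar>a\<bar> * (\<integral>\<^sup>+s. ennreal (exp (- ?z * (0 + a * s)) * binet (0 + a * s))
        * indicator {0<..} (0 + a * s) \<partial>lborel)"
      using a by (intro nn_integral_real_affine) auto
    also have "\<dots> = ennreal a * (\<integral>\<^sup>+s. ennreal (exp (- real (Suc n) * s) * binet (a * s))
        * indicator {0<..} s \<partial>lborel)"
    proof -
      have "- ?z * (0 + a * s) = - real (Suc n) * s" for s
        using a by (simp add: field_simps)
      moreover have "indicator {0<..} (0 + a * s) = (indicator {0<..} s :: ennreal)" for s
        using a by (simp add: indicator_def zero_less_mult_iff)
      ultimately show ?thesis
        using a by (simp only: add_0 abs_of_pos)
    qed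
    also have "\<dots> = (\<integral>\<^sup>+s. ennreal a * (ennreal (exp (- real (Suc n) * s) * binet (a * s))
        * indicator {0<..} s) \<partial>lborel)"
      by (intro nn_integral_cmult[symmetric]) simp
    also have "\<dots> = (\<integral>\<^sup>+s. ennreal (a * binet (a * s) * exp (- real (Suc n) * s)) * indicator {0<..} s \<partial>lborel)"
      using a by (intro nn_integral_cong)
        (auto simp: ennreal_mult'[symmetric] mult_ac split: split_indicator)
    finally show ?thesis .
  qed
  then have "(\<Sum>n. ennreal (S_term a (Suc n)))
      = (\<Sum>n. \<integral>\<^sup>+s. ennreal (a * binet (a * s) * exp (- real (Suc n) * s)) * indicator {0<..} s \<partial>lborel)"
    by simp
  also have "\<dots> = (\<integral>\<^sup>+s. ennreal (S_kernel a s) * indicator {0<..} s \<partial>lborel)"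
  proof (rule suminf_nn_integral)
    fix s :: real assume s: "s > 0"
    \<comment> \<open>The extra factor e^(-s) makes the geometric series start at exponent 1, which
      gives 1/(e^s - 1).\<close>
    have "(\<lambda>n. exp (- s) * exp (- real n * s)) sums (exp (- s) * (1 / (1 - exp (- s))))"
      by (intro sums_mult exp_minus_geometric_sums s)
    also have "exp (- s) * (1 / (1 - exp (- s))) = 1 / (exp s - 1)"
      using s by (simp add: exp_minus divide_simps)
    also have "(\<lambda>n. exp (- s) * exp (- real n * s)) = (\<lambda>n. exp (- real (Suc n) * s))"
      by (auto simp: algebra_simps simp flip: exp_add)
    finally have "(\<lambda>n. a * binet (a * s) * exp (- real (Suc n) * s)) sums (a * binet (a * s) * (1 / (exp s - 1)))"
      by (rule sums_mult)
    then show "(\<lambda>n. a * binet (a * s) * exp (- real (Suc n) * s)) sums S_kernel a s"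
      by (simp add: S_kernel_def)
  qed (use a binet_nonneg in auto)
  finally show ?thesis by simp
qed

text \<open>The exponential majorant makes the extended sum finite. As the terms are nonnegative,
  this gives summability, and the identity of extended integrals becomes one of real
  integrals.\<close>

lemma S_kernel_integral:
  assumes a: "a > 0"
  shows summable_S_term: "summable (\<lambda>n. S_term a (Suc n))"
    and set_integrable_S_kernel: "set_integrable lborel {0<..} (S_kernel a)"
    and set_integral_S_kernel: "(LINT s:{0<..}|lborel. S_kernel a s) = S a"
proof -
  have "(\<Sum>n. ennreal (S_term a (Suc n)))
      \<le> (\<integral>\<^sup>+s. ennreal (a\<^sup>2 / 2) * (ennreal (exp (- (1 / 2) * s)) * indicator {0<..} s) \<partial>lborel)"
    unfolding nn_integral_S_kernel[OF a, symmetric] using a S_kernel_le[OF a]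
    by (intro nn_integral_mono) (auto simp: ennreal_mult'[symmetric] intro!: ennreal_leI split: split_indicator)
  also have "\<dots> = ennreal (a\<^sup>2 / 2) * ennreal (1 / (1 / 2))"
    by (subst nn_integral_cmult) (use nn_integral_exp_minus_Ioi[of "1 / 2"] in simp_all)
  also have "\<dots> < top"
    by (simp add: ennreal_mult_less_top)
  finally have fin: "(\<Sum>n. ennreal (S_term a (Suc n))) \<noteq> top"
    by simp
  then show summable: "summable (\<lambda>n. S_term a (Suc n))"
    using S_term_nonneg[OF a] by (intro summable_suminf_not_top) auto
  have "has_bochner_integral lborel (\<lambda>s. indicator {0<..} s * S_kernel a s) (S a)"
  proof (rule has_bochner_integral_nn_integral)
    have "(\<integral>\<^sup>+s. ennreal (indicator {0<..} s * S_kernel a s) \<partial>lborel)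
        = (\<integral>\<^sup>+s. ennreal (S_kernel a s) * indicator {0<..} s \<partial>lborel)"
      by (intro nn_integral_cong) (auto split: split_indicator)
    then show "(\<integral>\<^sup>+s. ennreal (indicator {0<..} s * S_kernel a s) \<partial>lborel) = ennreal (S a)"
      using fin S_term_nonneg[OF a] by (simp add: nn_integral_S_kernel[OF a] S_def)
    show "S a \<ge> 0"
      unfolding S_def using S_term_nonneg[OF a] summable by (intro suminf_nonneg) auto
  qed (use a S_kernel_nonneg in \<open>auto split: split_indicator\<close>)
  then show "set_integrable lborel {0<..} (S_kernel a)" "(LINT s:{0<..}|lborel. S_kernel a s) = S a"
    by (auto simp: has_bochner_integral_iff set_integrable_def set_lebesgue_integral_def)
qed

section \<open>Truncated integrals and elementary antiderivatives\<close>

text \<open>Dominated convergence, with x = 1/y turning the limit at 0+ into one at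
  infinity.\<close>

lemma set_integral_Ici_tendsto_Ioi:
  fixes f :: "real \<Rightarrow> real"
  assumes f: "set_integrable lborel {0<..} f"
  shows "((\<lambda>x. LINT s:{x..}|lborel. f s) \<longlongrightarrow> (LINT s:{0<..}|lborel. f s)) (at_right 0)"
proof -
  \<comment> \<open>Extension by zero keeps the truncations dominated by the integrable |g| for
    every y, including y \<le> 0.\<close>
  define g where "g s = indicator {0<..} s * f s" for s
  have g: "integrable lborel g"
    using f by (simp add: set_integrable_def g_def[abs_def])
  have "((\<lambda>y. \<integral>s. indicator {inverse y..} s * g s \<partial>lborel) \<longlongrightarrow> (\<integral>s. g s \<partial>lborel)) at_top"
  proof (rule integral_dominated_convergence_at_top[where w = "\<lambda>s. norm (g s)"])
    show "AE s in lborel. ((\<lambda>y. indicator {inverse y..} s * g s) \<longlongrightarrow> g s) at_top"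
    proof (rule AE_I2)
      fix s :: real
      show "((\<lambda>y. indicator {inverse y..} s * g s) \<longlongrightarrow> g s) at_top"
      proof (cases "s > 0")
        case True
        have "eventually (\<lambda>y. indicator {inverse y..} s * g s = g s) at_top"
          using eventually_ge_at_top[of "inverse s"] eventually_gt_at_top[of 0]
          by eventually_elim (use True in \<open>auto simp: field_simps\<close>)
        then show ?thesis by (rule tendsto_eventually)
      qed (simp add: g_def)
    qed
  qed (use g in \<open>auto intro!: always_eventually AE_I2 split: split_indicator\<close>)
  then have "((\<lambda>x. \<integral>s. indicator {x..} s * g s \<partial>lborel) \<longlongrightarrow> (\<integral>s. g s \<partial>lborel)) (at_right 0)"
    by (simp add: filterlim_at_right_to_top)
  also have "?this \<longleftrightarrow> ?thesis"
  proof (rule tendsto_cong[THEN trans])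
    show "eventually (\<lambda>x. (\<integral>s. indicator {x..} s * g s \<partial>lborel) = (LINT s:{x..}|lborel. f s)) (at_right 0)"
      using eventually_at_right_less[of 0]
      by eventually_elim
        (auto simp: set_lebesgue_integral_def g_def intro!: Bochner_Integration.integral_cong split: split_indicator)
  qed (simp add: g_def set_lebesgue_integral_def)
  finally show ?thesis .
qed

lemma set_integral_FTC_atLeast_nonneg:
  fixes f F :: "real \<Rightarrow> real"
  assumes meas: "f \<in> borel_measurable borel"
    and deriv: "\<And>t. x \<le> t \<Longrightarrow> (F has_real_derivative f t) (at t)"
    and nonneg: "\<And>t. x \<le> t \<Longrightarrow> f t \<ge> 0"
    and lim: "(F \<longlongrightarrow> T) at_top"
  shows "set_integrable lborel {x..} f" "(LINT t:{x..}|lborel. f t) = T - F x"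
proof -
  \<comment> \<open>Needed so that \<open>ennreal (T - F x)\<close> does not truncate; it holds
    because F is nondecreasing on [x, oo).\<close>
  have "F x \<le> T"
  proof (rule tendsto_lowerbound[OF lim])
    show "eventually (\<lambda>t. F x \<le> F t) at_top"
      using eventually_ge_at_top[of x]
    proof eventually_elim
      case (elim t)
      then show ?case
        using deriv nonneg by (intro DERIV_nonneg_imp_nondecreasing[of x t F]) auto
    qed
  qed simp
  then have "has_bochner_integral lborel (\<lambda>t. indicator {x..} t * f t) (T - F x)"
  proof (intro has_bochner_integral_nn_integral)
    have "(\<integral>\<^sup>+t. ennreal (indicator {x..} t * f t) \<partial>lborel)
        = (\<integral>\<^sup>+t. ennreal (f t) * indicator {x..} t \<partial>lborel)"
      by (intro nn_integral_cong) (auto split: split_indicator)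
    also have "\<dots> = ennreal (T - F x)"
      using assms by (intro nn_integral_FTC_atLeast) auto
    finally show "(\<integral>\<^sup>+t. ennreal (indicator {x..} t * f t) \<partial>lborel) = ennreal (T - F x)" .
  qed (use meas nonneg in \<open>auto split: split_indicator\<close>)
  then show "set_integrable lborel {x..} f" "(LINT t:{x..}|lborel. f t) = T - F x"
    by (auto simp: has_bochner_integral_iff set_integrable_def set_lebesgue_integral_def)
qed

lemma set_integral_inverse_exp_minus_one:
  fixes x :: real
  assumes x: "x > 0"
  shows "set_integrable lborel {x..} (\<lambda>t. 1 / (exp t - 1))"
    and "(LINT t:{x..}|lborel. 1 / (exp t - 1)) = - ln (1 - exp (- x))"
proof -
  let ?F = "\<lambda>t::real. ln (1 - exp (- t))"
  have "(?F has_real_derivative 1 / (exp t - 1)) (at t)" if "x \<le> t" for t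
    using that x by (auto intro!: derivative_eq_intros simp: exp_minus field_simps)
  moreover have "(?F \<longlongrightarrow> 0) at_top"
    by real_asymp
  ultimately show "set_integrable lborel {x..} (\<lambda>t. 1 / (exp t - 1))"
    "(LINT t:{x..}|lborel. 1 / (exp t - 1)) = - ln (1 - exp (- x))"
    using set_integral_FTC_atLeast_nonneg[of "\<lambda>t. 1 / (exp t - 1)" x ?F 0] x by auto
qed

lemma set_integral_inverse_exp_minus_one_squared:
  fixes x :: real
  assumes x: "x > 0"
  shows "set_integrable lborel {x..} (\<lambda>t. 1 / (exp t - 1)\<^sup>2)"
    and "(LINT t:{x..}|lborel. 1 / (exp t - 1)\<^sup>2) = 1 / (exp x - 1) + ln (1 - exp (- x))"
proof -
  \<comment> \<open>Obtained by integrating 1/(e^t - 1)^2 = e^t/(e^t - 1)^2 - 1/(e^t - 1) term by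
    term.\<close>
  let ?F = "\<lambda>t::real. - 1 / (exp t - 1) - ln (1 - exp (- t))"
  have "(?F has_real_derivative 1 / (exp t - 1)\<^sup>2) (at t)" if "x \<le> t" for t
  proof -
    define p where "p = exp t - 1"
    have p: "p > 0" "exp t = p + 1" using that x by (simp_all add: p_def)
    have "exp (- t) = 1 / (p + 1)"
      by (simp add: exp_minus p(2) inverse_eq_divide)
    moreover have "1 - 1 / (p + 1) = p / (p + 1)"
      using p(1) by (simp add: field_simps)
    ultimately have frac: "exp (- t) / (1 - exp (- t)) = 1 / p"
      using p(1) by simp
    have "(?F has_real_derivative exp t / (exp t - 1)\<^sup>2 - exp (- t) / (1 - exp (- t))) (at t)"
      using that x by (auto intro!: derivative_eq_intros simp: power2_eq_square)
    also have "exp t / (exp t - 1)\<^sup>2 - exp (- t) / (1 - exp (- t)) = 1 / p\<^sup>2"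
      unfolding frac p(2) using p(1) by (simp add: add_divide_distrib power2_eq_square)
    finally show ?thesis
      by (simp add: p_def)
  qed
  moreover have "(?F \<longlongrightarrow> 0) at_top"
    by real_asymp
  ultimately show "set_integrable lborel {x..} (\<lambda>t. 1 / (exp t - 1)\<^sup>2)"
    "(LINT t:{x..}|lborel. 1 / (exp t - 1)\<^sup>2) = 1 / (exp x - 1) + ln (1 - exp (- x))"
    using set_integral_FTC_atLeast_nonneg[of "\<lambda>t. 1 / (exp t - 1)\<^sup>2" x ?F 0] x by auto
qed

section \<open>The integrand in terms of the kernels\<close>

text \<open>Since a phi(at) = a/2 + a/(e^(at) - 1) - 1/t, the term 1/t is the same for every a and
  cancels in K_a - K_1. Only elementary functions of e^t remain besides the integrand.\<close>

lemma kernel_decomposition: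
  assumes "a > 0" "t > 0"
  shows "a / ((exp t - 1) * (exp (a * t) - 1))
    = S_kernel a t - S_kernel 1 t + 1 / (exp t - 1)\<^sup>2 - (a - 1) / 2 * (1 / (exp t - 1))"
proof -
  define p q where "p = exp t - 1" and "q = exp (a * t) - 1"
  have "a * binet (a * t) = a / 2 + a / q - 1 / t"
    using assms by (simp add: binet_def q_def field_simps)
  moreover have "binet t = 1 / 2 + 1 / p - 1 / t"
    by (simp add: binet_def p_def)
  moreover have "a / (p * q) = (a / 2 + a / q - 1 / t) / p - (1 / 2 + 1 / p - 1 / t) / p
      + 1 / p\<^sup>2 - (a - 1) / 2 * (1 / p)"
    by (simp add: add_divide_distrib diff_divide_distrib power2_eq_square mult.commute)
  ultimately show ?thesis
    by (simp add: S_kernel_def flip: p_def q_def)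
qed

text \<open>The logarithm has coefficient 1 from the squared term and (a - 1)/2 from the simple one.
  Their sum (1 + a)/2 is the coefficient of ln x in the theorem.\<close>

lemma set_integral_kernel:
  assumes a: "a > 0" and x: "x > 0"
  shows "set_integrable lborel {x..} (\<lambda>t. a / ((exp t - 1) * (exp (a * t) - 1)))"
    and "(LINT t:{x..}|lborel. a / ((exp t - 1) * (exp (a * t) - 1)))
      = (LINT t:{x..}|lborel. S_kernel a t) - (LINT t:{x..}|lborel. S_kernel 1 t)
        + 1 / (exp x - 1) + (1 + a) / 2 * ln (1 - exp (- x))"
proof -
  let ?g = "\<lambda>t. S_kernel a t - S_kernel 1 t + 1 / (exp t - 1)\<^sup>2 - (a - 1) / 2 * (1 / (exp t - 1))"
  have K: "set_integrable lborel {x..} (S_kernel b)" if "b > 0" for b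
    using x by (intro set_integrable_subset[OF set_integrable_S_kernel[OF that]]) auto
  note int = K[OF a] K[OF zero_less_one]
    set_integral_inverse_exp_minus_one(1)[OF x] set_integral_inverse_exp_minus_one_squared(1)[OF x]
  have eq: "a / ((exp t - 1) * (exp (a * t) - 1)) = ?g t" if "t \<in> {x..}" for t
    using that x by (intro kernel_decomposition a) auto
  have "set_integrable lborel {x..} ?g"
    using int by (intro set_integral_add set_integral_diff set_integrable_mult_right) auto
  then show "set_integrable lborel {x..} (\<lambda>t. a / ((exp t - 1) * (exp (a * t) - 1)))"
    using eq by (subst set_integrable_cong[OF refl refl]) auto
  have "(LINT t:{x..}|lborel. a / ((exp t - 1) * (exp (a * t) - 1))) = (LINT t:{x..}|lborel. ?g t)"
    using eq by (intro set_lebesgue_integral_cong) auto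
  also have "\<dots> = (LINT t:{x..}|lborel. S_kernel a t) - (LINT t:{x..}|lborel. S_kernel 1 t)
      + (LINT t:{x..}|lborel. 1 / (exp t - 1)\<^sup>2) - (a - 1) / 2 * (LINT t:{x..}|lborel. 1 / (exp t - 1))"
    using int by (simp add: set_integral_add set_integral_diff set_integrable_mult_right del: times_divide_eq_right)
  also have "\<dots> = (LINT t:{x..}|lborel. S_kernel a t) - (LINT t:{x..}|lborel. S_kernel 1 t)
        + 1 / (exp x - 1) + (1 + a) / 2 * ln (1 - exp (- x))"
    by (simp add: set_integral_inverse_exp_minus_one[OF x] set_integral_inverse_exp_minus_one_squared[OF x]
        field_simps)
  finally show "(LINT t:{x..}|lborel. a / ((exp t - 1) * (exp (a * t) - 1)))
      = (LINT t:{x..}|lborel. S_kernel a t) - (LINT t:{x..}|lborel. S_kernel 1 t)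
        + 1 / (exp x - 1) + (1 + a) / 2 * ln (1 - exp (- x))" .
qed

section \<open>The value of S(1)\<close>

text \<open>Follows from \<open>euler_mascheroni_bounds\<close>, whose two sides differ only by
  1/(2n) against 1/(2(n+1)). Both bounds have the limit 1 - 1/2 after multiplication by n.\<close>

lemma harm_asymp_first_order:
  "(\<lambda>n. real n * (harm n - ln (real n) - euler_mascheroni)) \<longlonglongrightarrow> 1 / 2"
proof (rule tendsto_sandwich)
  show "(\<lambda>n. real n * (ln (real n + 1) - ln (real n) - 1 / (2 * real n))) \<longlonglongrightarrow> 1 / 2"
    by real_asymp
  show "(\<lambda>n. real n * (ln (real n + 1) - ln (real n) - 1 / (2 * (real n + 1)))) \<longlonglongrightarrow> 1 / 2"
    by real_asymp
  show "\<forall>\<^sub>F n in sequentially. real n * (ln (real n + 1) - ln (real n) - 1 / (2 * real n))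
      \<le> real n * (harm n - ln (real n) - euler_mascheroni)"
    using eventually_ge_at_top[of 1]
  proof eventually_elim
    case (elim n)
    then show ?case
      using euler_mascheroni_bounds[of n] by (intro mult_left_mono) (auto simp: inverse_eq_divide add_ac)
  qed
  show "\<forall>\<^sub>F n in sequentially. real n * (harm n - ln (real n) - euler_mascheroni)
      \<le> real n * (ln (real n + 1) - ln (real n) - 1 / (2 * (real n + 1)))"
    using eventually_ge_at_top[of 1]
  proof eventually_elim
    case (elim n)
    then show ?case
      using euler_mascheroni_bounds[of n] by (intro mult_left_mono) (auto simp: inverse_eq_divide add_ac)
  qed
qed

text \<open>Each factor is (2k)^2 / ((2k-1)(2k+1)), so the partial product is a quotient of
  factorials. Without division, its logarithm splits directly into a sum.\<close>

lemma wallis_prod_eq: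
  "(\<Prod>k=1..n. (4 * real k ^ 2) / (4 * real k ^ 2 - 1)) * ((fact (2 * n))\<^sup>2 * (2 * real n + 1))
     = 2 ^ (4 * n) * fact n ^ 4"
proof (induction n)
  case (Suc n)
  define r where "r = real n"
  define W where "W = (\<Prod>k=1..n. (4 * real k ^ 2) / (4 * real k ^ 2 - 1))"
  have f: "fact (2 * Suc n) = (2 * r + 2) * (2 * r + 1) * fact (2 * n)"
    by (simp add: r_def algebra_simps)
  have "(\<Prod>k=1..Suc n. (4 * real k ^ 2) / (4 * real k ^ 2 - 1)) * ((fact (2 * Suc n))\<^sup>2 * (2 * real (Suc n) + 1))
      = W * (4 * (r + 1)\<^sup>2 / (4 * (r + 1)\<^sup>2 - 1)) * (((2 * r + 2) * (2 * r + 1) * fact (2 * n))\<^sup>2 * (2 * r + 3))"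
    unfolding f by (simp add: W_def r_def add_ac)
  also have "4 * (r + 1)\<^sup>2 - 1 = (2 * r + 1) * (2 * r + 3)"
    by (simp add: algebra_simps power2_eq_square)
  also have "W * (4 * (r + 1)\<^sup>2 / ((2 * r + 1) * (2 * r + 3))) * (((2 * r + 2) * (2 * r + 1) * fact (2 * n))\<^sup>2 * (2 * r + 3))
      = 16 * (r + 1) ^ 4 * (W * ((fact (2 * n))\<^sup>2 * (2 * r + 1)))"
  proof -
    have "2 * r + 1 \<noteq> 0" "2 * r + 3 \<noteq> 0" by (simp_all add: r_def add_nonneg_eq_0_iff)
    then show ?thesis by (simp add: divide_simps) (simp add: power2_eq_square power4_eq_xxxx algebra_simps)
  qed
  also have "W * ((fact (2 * n))\<^sup>2 * (2 * r + 1)) = 2 ^ (4 * n) * fact n ^ 4"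
    using Suc.IH by (simp add: W_def r_def)
  also have "16 * (r + 1) ^ 4 * (2 ^ (4 * n) * fact n ^ 4) = 2 ^ (4 * Suc n) * fact (Suc n) ^ 4"
    by (simp add: r_def power_mult_distrib add_ac power_add)
  finally show ?case .
qed simp

text \<open>In 4 s(n) - 2 s(2n) the terms of order n ln n and the linear terms from s cancel, and
  what is left is the logarithm of Wallis' product up to an elementary correction. Hence 2c - 2 ln 2
  = ln(pi/2).\<close>

lemma stirling_constant:
  assumes lim: "(\<lambda>n. ln (fact n) - (real n + 1 / 2) * ln (real n) + real n) \<longlonglongrightarrow> c"
  shows "c = ln (2 * pi) / 2"
proof -
  define s where "s n = ln (fact n) - (real n + 1 / 2) * ln (real n) + real n" for n
  define W where "W n = (\<Prod>k=1..n. (4 * real k ^ 2) / (4 * real k ^ 2 - 1))" for n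
  have s: "s \<longlonglongrightarrow> c" using lim by (simp add: s_def[abs_def])
  have "(\<lambda>n. s (2 * n)) \<longlonglongrightarrow> c"
    using s by (rule LIMSEQ_subseq_LIMSEQ[unfolded comp_def]) (simp add: strict_mono_def)
  \<comment> \<open>This is exactly the difference between ln W(n) and 4 s(n) - 2 s(2n).\<close>
  moreover have "(\<lambda>n. ln (real n) - ln 2 - ln (2 * real n + 1)) \<longlonglongrightarrow> - (2 * ln 2)"
    by real_asymp
  ultimately have "(\<lambda>n. 4 * s n - 2 * s (2 * n) + (ln (real n) - ln 2 - ln (2 * real n + 1)))
      \<longlonglongrightarrow> 4 * c - 2 * c + - (2 * ln 2)"
    using s by (intro tendsto_intros)
  moreover have "eventually (\<lambda>n. 4 * s n - 2 * s (2 * n) + (ln (real n) - ln 2 - ln (2 * real n + 1)) = ln (W n)) sequentially"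
    using eventually_gt_at_top[of 0]
  proof eventually_elim
    case (elim n)
    have eq: "W n * ((fact (2 * n))\<^sup>2 * (2 * real n + 1)) = 2 ^ (4 * n) * fact n ^ 4"
      unfolding W_def by (rule wallis_prod_eq)
    have "W n > 0"
    proof -
      have "W n * ((fact (2 * n))\<^sup>2 * (2 * real n + 1)) > 0" unfolding eq by simp
      then show ?thesis by (rule zero_less_mult_pos2) simp
    qed
    moreover have "ln (W n * ((fact (2 * n))\<^sup>2 * (2 * real n + 1))) = ln (2 ^ (4 * n) * fact n ^ 4)"
      by (simp only: eq)
    ultimately have "ln (W n) + 2 * ln (fact (2 * n)) + ln (2 * real n + 1) = 4 * real n * ln 2 + 4 * ln (fact n)"
      by (simp add: ln_mult_pos ln_realpow)
    moreover have "ln (2 * real n) = ln 2 + ln (real n)"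
      using elim by (simp add: ln_mult_pos)
    ultimately show ?case
      by (simp add: s_def algebra_simps)
  qed
  ultimately have "(\<lambda>n. ln (W n)) \<longlonglongrightarrow> 4 * c - 2 * c + - (2 * ln 2)"
    by (rule Lim_transform_eventually)
  moreover have "(\<lambda>n. ln (W n)) \<longlonglongrightarrow> ln (pi / 2)"
    unfolding W_def by (intro tendsto_ln wallis) simp
  ultimately have "4 * c - 2 * c + - (2 * ln 2) = ln (pi / 2)"
    by (rule LIMSEQ_unique)
  then show ?thesis by (simp add: ln_div ln_mult)
qed

lemma S_1: "S 1 = (ln (2 * pi) - euler_mascheroni - 1) / 2"
proof -
  have part: "(\<Sum>n<N. S_term 1 (Suc n))
      = ln (fact N) - harm N / 2 - (real N * harm N - real N) + real N * euler_mascheroni" for N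
  proof (induction N)
    case (Suc N)
    \<comment> \<open>The term added in this step is the one for n = N + 1, so its digamma value
      involves H_N rather than H_(N+1).\<close>
    have D: "Digamma (1 + real N) = harm N - euler_mascheroni"
      using Digamma_of_nat[of N, where 'a = real] by simp
    have "S_term 1 (Suc N) = ln (real N + 1) - 1 / (2 * real (Suc N)) - (harm N - euler_mascheroni)"
      by (simp add: S_term_def D add_ac)
    moreover have "ln (fact (Suc N) :: real) = ln (real N + 1) + ln (fact N)"
      by (simp add: ln_mult_pos add_ac del: of_nat_Suc flip: of_nat_Suc)
    moreover have "real (Suc N) * harm (Suc N) = real N * harm N + harm N + 1"
    proof -
      have "real (Suc N) * harm (Suc N) = real (Suc N) * harm N + 1"
        by (simp add: harm_Suc distrib_left del: of_nat_Suc)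
      then show ?thesis by (simp add: distrib_right)
    qed
    moreover have "harm (Suc N) / 2 = harm N / 2 + 1 / (2 * real (Suc N))"
      by (simp add: harm_Suc inverse_eq_divide add_divide_distrib del: of_nat_Suc)
    moreover have "real (Suc N) * euler_mascheroni = real N * euler_mascheroni + euler_mascheroni"
      by (simp add: distrib_right)
    moreover have "real (Suc N) = real N + 1"
      by simp
    ultimately show ?case
      unfolding sum.lessThan_Suc Suc.IH by argo
  qed (simp add: harm_def)
  \<comment> \<open>The two added sequences have known limits and are chosen to remove H_N and
    \<open>euler_mascheroni\<close> from the partial sum, which leaves the Stirling
    expression.\<close>
  have "(\<lambda>N. (\<Sum>n<N. S_term 1 (Suc n)) + (harm N - ln (real N)) / 2
      + real N * (harm N - ln (real N) - euler_mascheroni)) \<longlonglongrightarrow> S 1 + euler_mascheroni / 2 + 1 / 2"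
    unfolding S_def using summable_S_term[of 1]
    by (intro tendsto_intros harm_asymp_first_order summable_LIMSEQ euler_mascheroni_LIMSEQ) auto
  also have "(\<lambda>N. (\<Sum>n<N. S_term 1 (Suc n)) + (harm N - ln (real N)) / 2
      + real N * (harm N - ln (real N) - euler_mascheroni))
      = (\<lambda>N. ln (fact N) - (real N + 1 / 2) * ln (real N) + real N)"
    by (simp add: part algebra_simps diff_divide_distrib)
  finally show ?thesis
    using stirling_constant by fastforce
qed

section \<open>The limit at 0+\<close>

theorem mainTheorem3:
  fixes a :: real
  assumes "a > 0"
  shows "summable (\<lambda>n. S_term a (Suc n)) \<and>
    (\<forall>x>0. (\<lambda>t. a / ((exp t - 1) * (exp (a * t) - 1))) integrable_on {x..}) \<and>
    ((\<lambda>x. integral {x..} (\<lambda>t. a / ((exp t - 1) * (exp (a * t) - 1)))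
            - 1 / x - (1 + a) / 2 * ln x)
       \<longlongrightarrow> S a - (ln (2 * pi) - euler_mascheroni) / 2) (at_right 0)"
proof (intro conjI allI impI)
  let ?f = "\<lambda>t. a / ((exp t - 1) * (exp (a * t) - 1))"
  show "summable (\<lambda>n. S_term a (Suc n))"
    using assms by (rule summable_S_term)
  show "?f integrable_on {x..}" if "x > 0" for x
    using set_integral_kernel(1)[OF assms that] by (rule set_borel_integral_eq_integral)
  \<comment> \<open>The elementary part: 1/(e^x - 1) = 1/x - 1/2 + O(x) and (1 - e^(-x))/x tends to
    1, so only -1/2 survives.\<close>
  have "((\<lambda>x. 1 / (exp x - 1) - 1 / x + (1 + a) / 2 * (ln (1 - exp (- x)) - ln x))
      \<longlongrightarrow> - (1 / 2) + (1 + a) / 2 * 0) (at_right 0)"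
  proof (intro tendsto_add tendsto_mult tendsto_const)
    show "((\<lambda>x::real. 1 / (exp x - 1) - 1 / x) \<longlongrightarrow> - (1 / 2)) (at_right 0)"
      by real_asymp
    show "((\<lambda>x::real. ln (1 - exp (- x)) - ln x) \<longlongrightarrow> 0) (at_right 0)"
      by real_asymp
  qed
  moreover have "((\<lambda>x. (LINT t:{x..}|lborel. S_kernel a t) - (LINT t:{x..}|lborel. S_kernel 1 t))
      \<longlongrightarrow> S a - S 1) (at_right 0)"
    using assms set_integral_Ici_tendsto_Ioi[OF set_integrable_S_kernel]
    by (intro tendsto_diff) (auto simp flip: set_integral_S_kernel)
  ultimately have lim: "((\<lambda>x. ((LINT t:{x..}|lborel. S_kernel a t) - (LINT t:{x..}|lborel. S_kernel 1 t))
      + (1 / (exp x - 1) - 1 / x + (1 + a) / 2 * (ln (1 - exp (- x)) - ln x)))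
      \<longlongrightarrow> (S a - S 1) + (- (1 / 2) + (1 + a) / 2 * 0)) (at_right 0)"
    by (rule tendsto_add[rotated])
  have eq: "(S a - S 1) + (- (1 / 2) + (1 + a) / 2 * 0) = S a - (ln (2 * pi) - euler_mascheroni) / 2"
    by (simp add: S_1 field_simps)
  have ev: "eventually (\<lambda>x. ((LINT t:{x..}|lborel. S_kernel a t) - (LINT t:{x..}|lborel. S_kernel 1 t))
      + (1 / (exp x - 1) - 1 / x + (1 + a) / 2 * (ln (1 - exp (- x)) - ln x))
      = integral {x..} ?f - 1 / x - (1 + a) / 2 * ln x) (at_right 0)"
    using eventually_at_right_less[of 0]
  proof eventually_elim
    case (elim x)
    \<comment> \<open>The theorem is stated with the Henstock-Kurzweil integral, which agrees with
      the Lebesgue integral for this set-integrable function.\<close>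
    have "integral {x..} ?f = (LINT t:{x..}|lborel. ?f t)"
      using set_integral_kernel(1)[OF assms elim] by (rule set_borel_integral_eq_integral(2)[symmetric])
    then show ?case
      unfolding set_integral_kernel(2)[OF assms elim] by (simp add: right_diff_distrib)
  qed
  show "((\<lambda>x. integral {x..} ?f - 1 / x - (1 + a) / 2 * ln x)
      \<longlongrightarrow> S a - (ln (2 * pi) - euler_mascheroni) / 2) (at_right 0)"
    using Lim_transform_eventually[OF lim ev] unfolding eq .
qed

end
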